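(* Let $T$ be a Leibniz triple system with nilpotent radical $N(T)$, and suppose $Nil(U(T))$ is the nilpotent radical of the universal Leibniz envelope $U(T)$. Then $N(T)=Nil(U(T))\cap T$.
   Context: All vector spaces are finite-dimensional over a fixed field $\mathbb{K}$ of characteristic $0$. Products of subspaces denote linear spans. A Leibniz triple system is a vector space $T$ with a trilinear operation $\{\cdot,\cdot,\cdot\}:T\times T\times T\to T$ satisfying, for all $a,b,c,d,e\in T$, $\{a\{bcd\}e\}=\{\{abc\}de\}-\{\{acb\}de\}-\{\{adb\}ce\}+\{\{adc\}be\}$ and $\{ab\{cde\}\}=\{\{abc\}de\}-\{\{abd\}ce\}-\{\{abe\}cd\}+\{\{abe\}dc\}$. An ideal of $T$ is a subspace $I$ with $\{ITT\}+\{TIT\}+\{TTI\}\subseteq I$. A (right) Leibniz algebra is a vector space with a bilinear bracket satisfying $[[x,y],z]=[[x,z],y]+[x,[y,z]]$; ideals are two-sided. The universal Leibniz envelope of $T$ is the Leibniz algebra $U(T)=T\oplus(T\otimes T)$ with bracket $[a,b]=a\otimes b$, $[a\otimes b,c]=\{abc\}$, $[a,b\otimes c]=\{abc\}-\{acb\}$, $[a\otimes b,c\otimes d]=\{abc\}\otimes d-\{abd\}\otimes c$. $T$ is identified with the first summand. For an ideal $I$ of $T$: $I^0=I$ and, for $n\ge 0$, $I^{n+1}=\{I^{n}IT\}+\{I^{n}TI\}+\{II^{n}T\}+\{ITI^{n}\}+\{TII^{n}\}+\{TI^{n}I\}$; $I$ is nilpotent if $I^n=0$ for some $n\in\mathbb{N}$.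 $N(T)$ is the sum of all nilpotent ideals of $T$ (the unique maximal nilpotent ideal of $T$). For an ideal $V$ of a Leibniz algebra, $V^0=V$, $V^{n+1}=[V^n,V]$, and $V$ is nilpotent if $V^n=0$ for some $n$; the nilpotent radical of a Leibniz algebra is its largest nilpotent ideal. *)

theory Defs
  imports
    Complex_Main
    "HOL-Library.Function_Algebras"
    "HOL-Library.Product_Plus"
    "HOL-Library.Set_Algebras"
begin

section \<open>Leibniz algebras\<close>

text \<open>The algebra lives on a subspace \<open>L\<close> of an ambient vector space, because the universal Leibniz
  envelope below is not the universe of a type. Values of the bracket outside \<open>L\<close> are irrelevant.

  Ideals, their powers, nilpotency and the nilpotent radical are defined for any bilinear bracket.
  This is necessary: on \<open>T \<oplus> (T \<otimes> T)\<close> with the full tensor product, the bracket of the envelope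
  satisfies the Leibniz identity only up to elements of \<open>T \<otimes> T\<close>. For instance,
  \<open>[[a, a], z \<otimes> w] = [[a, z \<otimes> w], a] + [a, [a, z \<otimes> w]]\<close> reads
  \<open>{aaz} \<otimes> w - {aaw} \<otimes> z = v \<otimes> a + a \<otimes> v\<close> with \<open>v = {azw} - {awz}\<close>. For the triple product
  \<open>{abc} = [[a, b], c]\<close> of a Lie algebra the left side is \<open>0\<close> and \<open>v = [a, [z, w]]\<close>, so the equation
  fails in \<open>sl\<^sub>2\<close> for \<open>a = z = h\<close>, \<open>w = e\<close>.\<close>

locale bracket_algebra = vector_space scale
  for scale :: "'k::field_char_0 \<Rightarrow> 'v::ab_group_add \<Rightarrow> 'v" (infixr \<open>*s\<close> 75) +
  fixes L :: "'v set" and br :: "'v \<Rightarrow> 'v \<Rightarrow> 'v"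
  assumes subspace_carrier: "subspace L"
    and finite_dim: "\<exists>B. finite B \<and> span B = L"
    and br_closed: "x \<in> L \<Longrightarrow> y \<in> L \<Longrightarrow> br x y \<in> L"
    and br_add_left: "x \<in> L \<Longrightarrow> y \<in> L \<Longrightarrow> z \<in> L \<Longrightarrow> br (x + y) z = br x z + br y z"
    and br_add_right: "x \<in> L \<Longrightarrow> y \<in> L \<Longrightarrow> z \<in> L \<Longrightarrow> br x (y + z) = br x y + br x z"
    and br_scale_left: "x \<in> L \<Longrightarrow> y \<in> L \<Longrightarrow> br (c *s x) y = c *s br x y"
    and br_scale_right: "x \<in> L \<Longrightarrow> y \<in> L \<Longrightarrow> br x (c *s y) = c *s br x y"
begin

definition br_span :: "'v set \<Rightarrow> 'v set \<Rightarrow> 'v set" where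
  "br_span A B = span {br x y | x y. x \<in> A \<and> y \<in> B}"

definition ideal :: "'v set \<Rightarrow> bool" where
  "ideal V \<longleftrightarrow> subspace V \<and> V \<subseteq> L \<and> br_span V L \<subseteq> V \<and> br_span L V \<subseteq> V"

primrec ideal_power :: "'v set \<Rightarrow> nat \<Rightarrow> 'v set" where
  "ideal_power V 0 = V"
| "ideal_power V (Suc n) = br_span (ideal_power V n) V"

definition nilpotent_ideal :: "'v set \<Rightarrow> bool" where
  "nilpotent_ideal V \<longleftrightarrow> ideal V \<and> (\<exists>n. ideal_power V n = {0})"

definition is_nilpotent_radical :: "'v set \<Rightarrow> bool" where
  "is_nilpotent_radical V \<longleftrightarrow> nilpotent_ideal V \<and> (\<forall>W. nilpotent_ideal W \<longrightarrow> W \<subseteq> V)"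

end

locale leibniz_algebra = bracket_algebra +
  assumes leibniz: "x \<in> L \<Longrightarrow> y \<in> L \<Longrightarrow> z \<in> L \<Longrightarrow> br (br x y) z = br (br x z) y + br x (br y z)"

section \<open>Leibniz triple systems\<close>

locale leibniz_triple_system = vector_space scale
  for scale :: "'k::field_char_0 \<Rightarrow> 'a::ab_group_add \<Rightarrow> 'a" (infixr \<open>*s\<close> 75) +
  fixes tri :: "'a \<Rightarrow> 'a \<Rightarrow> 'a \<Rightarrow> 'a"
  assumes finite_dim: "\<exists>B. finite B \<and> span B = UNIV"
    and linear_1: "Vector_Spaces.linear scale scale (\<lambda>x. tri x b c)"
    and linear_2: "Vector_Spaces.linear scale scale (\<lambda>x. tri a x c)"
    and linear_3: "Vector_Spaces.linear scale scale (\<lambda>x. tri a b x)"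
    and lts_middle: "tri a (tri b c d) e =
      tri (tri a b c) d e - tri (tri a c b) d e - tri (tri a d b) c e + tri (tri a d c) b e"
    and lts_right: "tri a b (tri c d e) =
      tri (tri a b c) d e - tri (tri a b d) c e - tri (tri a b e) c d + tri (tri a b e) d c"
begin

definition tri_span :: "'a set \<Rightarrow> 'a set \<Rightarrow> 'a set \<Rightarrow> 'a set" where
  "tri_span A B C = span {tri a b c | a b c. a \<in> A \<and> b \<in> B \<and> c \<in> C}"

definition ideal :: "'a set \<Rightarrow> bool" where
  "ideal I \<longleftrightarrow> subspace I \<and>
     tri_span I UNIV UNIV + tri_span UNIV I UNIV + tri_span UNIV UNIV I \<subseteq> I"

primrec ideal_power :: "'a set \<Rightarrow> nat \<Rightarrow> 'a set" where
  "ideal_power I 0 = I"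
| "ideal_power I (Suc n) =
     tri_span (ideal_power I n) I UNIV + tri_span (ideal_power I n) UNIV I +
     tri_span I (ideal_power I n) UNIV + tri_span I UNIV (ideal_power I n) +
     tri_span UNIV I (ideal_power I n) + tri_span UNIV (ideal_power I n) I"

definition nilpotent_ideal :: "'a set \<Rightarrow> bool" where
  "nilpotent_ideal I \<longleftrightarrow> ideal I \<and> (\<exists>n. ideal_power I n = {0})"

text \<open>The sum of a family of subspaces is the span of their union.\<close>

definition nil_radical :: "'a set" where
  "nil_radical = span (\<Union>{I. nilpotent_ideal I})"

end

section \<open>The tensor square of a vector space\<close>

text \<open>\<open>T \<otimes> T\<close> is realised inside the dual of the space of bilinear forms on \<open>T\<close>: the tensor \<open>a \<otimes> b\<close> is
  evaluation of bilinear forms at \<open>(a, b)\<close>, and \<open>T \<otimes> T\<close> is the span of these. A functional on bilinear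
  forms is represented by a function on all of \<open>'a \<Rightarrow> 'a \<Rightarrow> 'k\<close> that vanishes off the bilinear forms.
  The theorems \<open>bilinear_tensor\<close>, \<open>tensor_universal\<close> and \<open>tensor_universal_unique\<close> below state the
  universal property, for bilinear maps into an arbitrary vector space.\<close>

type_synonym ('a, 'k) tensor = "('a \<Rightarrow> 'a \<Rightarrow> 'k) \<Rightarrow> 'k"

definition tensor_scale :: "'k::field \<Rightarrow> ('a, 'k) tensor \<Rightarrow> ('a, 'k) tensor" where
  "tensor_scale c t = (\<lambda>f. c * t f)"

definition bilinear_map ::
  "('k::field \<Rightarrow> 'a::ab_group_add \<Rightarrow> 'a) \<Rightarrow> ('k \<Rightarrow> 'c::ab_group_add \<Rightarrow> 'c) \<Rightarrow> ('a \<Rightarrow> 'a \<Rightarrow> 'c) \<Rightarrow> bool" where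
  "bilinear_map scale scale' f \<longleftrightarrow>
     (\<forall>y. Vector_Spaces.linear scale scale' (\<lambda>x. f x y)) \<and>
     (\<forall>x. Vector_Spaces.linear scale scale' (\<lambda>y. f x y))"

definition tensor ::
  "('k::field \<Rightarrow> 'a::ab_group_add \<Rightarrow> 'a) \<Rightarrow> 'a \<Rightarrow> 'a \<Rightarrow> ('a, 'k) tensor" where
  "tensor scale a b = (\<lambda>f. if bilinear_map scale (*) f then f a b else 0)"

definition tensor_space :: "('k::field \<Rightarrow> 'a::ab_group_add \<Rightarrow> 'a) \<Rightarrow> ('a, 'k) tensor set" where
  "tensor_space scale = module.span tensor_scale {tensor scale a b | a b. True}"

text \<open>The linear map induced by a bilinear map \<open>f\<close>. It is chosen on the whole ambient function space;
  only its values on \<open>tensor_space scale\<close>, where it is unique, are meaningful.\<close>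

definition tensor_lift ::
  "('k::field \<Rightarrow> 'a::ab_group_add \<Rightarrow> 'a) \<Rightarrow> ('k \<Rightarrow> 'c::ab_group_add \<Rightarrow> 'c) \<Rightarrow> ('a \<Rightarrow> 'a \<Rightarrow> 'c)
     \<Rightarrow> ('a, 'k) tensor \<Rightarrow> 'c" where
  "tensor_lift scale scale' f =
     (SOME g. Vector_Spaces.linear tensor_scale scale' g \<and> (\<forall>a b. g (tensor scale a b) = f a b))"

lemma vector_space_tensor: "vector_space tensor_scale"
  by unfold_locales (auto simp: tensor_scale_def fun_eq_iff algebra_simps)

lemma vector_space_field: "vector_space ((*) :: 'k::field \<Rightarrow> 'k \<Rightarrow> 'k)"
  by unfold_locales (auto simp: algebra_simps)

lemma bilinear_mapD:
  assumes "bilinear_map s s' f"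
  shows "f (x + x') y = f x y + f x' y" "f (s c x) y = s' c (f x y)"
    "f x (y + y') = f x y + f x y'" "f x (s c y) = s' c (f x y)"
  using assms unfolding bilinear_map_def Vector_Spaces.linear_iff by blast+

lemma bilinear_mapI:
  assumes "vector_space s" "vector_space s'"
    and "\<And>x x' y. f (x + x') y = f x y + f x' y" "\<And>c x y. f (s c x) y = s' c (f x y)"
    and "\<And>x y y'. f x (y + y') = f x y + f x y'" "\<And>c x y. f x (s c y) = s' c (f x y)"
  shows "bilinear_map s s' f"
  using assms unfolding bilinear_map_def Vector_Spaces.linear_iff by blast

theorem bilinear_tensor:
  assumes "vector_space scale"
  shows "bilinear_map scale tensor_scale (tensor scale)"
  by (rule bilinear_mapI[OF assms vector_space_tensor])
    (auto simp: tensor_def tensor_scale_def fun_eq_iff bilinear_mapD)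

theorem tensor_universal:
  fixes scale :: "'k::field \<Rightarrow> 'a::ab_group_add \<Rightarrow> 'a"
    and scale' :: "'k \<Rightarrow> 'c::ab_group_add \<Rightarrow> 'c"
  assumes f: "bilinear_map scale scale' f"
  shows "\<exists>g. Vector_Spaces.linear tensor_scale scale' g \<and> (\<forall>a b. g (tensor scale a b) = f a b)"
proof -
  have vs: "vector_space scale" "vector_space scale'"
    using f by (auto simp: bilinear_map_def Vector_Spaces.linear_iff)
  interpret T: vector_space_pair "tensor_scale :: 'k \<Rightarrow> ('a, 'k) tensor \<Rightarrow> _" scale'
    using vs vector_space_tensor by (simp add: vector_space_pair_def)
  interpret D: vector_space_pair scale' "(*)"
    using vs vector_space_field by (simp add: vector_space_pair_def)
  let ?S = "{tensor scale a b | a b. True}"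
  obtain B where B: "B \<subseteq> ?S" "T.vs1.independent B" "?S \<subseteq> T.vs1.span B"
    using T.vs1.maximal_independent_subset by blast
  have "\<forall>t\<in>B. \<exists>p. t = tensor scale (fst p) (snd p)" using B(1) by force
  then obtain p where p: "\<And>t. t \<in> B \<Longrightarrow> t = tensor scale (fst (p t)) (snd (p t))" by metis
  obtain g where g: "Vector_Spaces.linear tensor_scale scale' g"
      "\<And>t. t \<in> B \<Longrightarrow> g t = f (fst (p t)) (snd (p t))"
    using T.linear_independent_extend[OF B(2), of "\<lambda>t. f (fst (p t)) (snd (p t))"] by blast
  have "g (tensor scale a b) = f a b" for a b
  proof (rule ccontr)
    assume ne: "g (tensor scale a b) \<noteq> f a b"
    let ?z = "g (tensor scale a b) - f a b"
    have "T.vs2.independent {?z}" using ne by simp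
    then obtain \<phi> where \<phi>: "Vector_Spaces.linear scale' (*) \<phi>" "\<phi> ?z = 1"
      using D.linear_independent_extend[of "{?z}" "\<lambda>_. 1"] by blast
    let ?h = "\<lambda>x y. \<phi> (f x y)"
    have h: "bilinear_map scale (*) ?h"
      by (rule bilinear_mapI[OF vs(1) vector_space_field])
        (use \<phi>(1) in \<open>auto simp: bilinear_mapD[OF f] Vector_Spaces.linear_iff\<close>)
    let ?ev = "\<lambda>t::('a, 'k) tensor. t ?h"
    interpret P: vector_space_pair "tensor_scale :: 'k \<Rightarrow> ('a, 'k) tensor \<Rightarrow> _" "(*) :: 'k \<Rightarrow> 'k \<Rightarrow> 'k"
      using vector_space_tensor vector_space_field by (simp add: vector_space_pair_def)
    have l1: "Vector_Spaces.linear tensor_scale (*) ?ev"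
      unfolding Vector_Spaces.linear_iff
      using vector_space_tensor vector_space_field by (auto simp: tensor_scale_def)
    have l2: "Vector_Spaces.linear tensor_scale (*) (\<lambda>t. \<phi> (g t))"
      using g(1) \<phi>(1) unfolding Vector_Spaces.linear_iff by auto
    have "?ev (tensor scale a b) = \<phi> (g (tensor scale a b))"
    proof (rule P.linear_eq_on[OF l1 l2, where B = B])
      show "tensor scale a b \<in> T.vs1.span B" using B(3) by blast
      fix t assume t: "t \<in> B"
      have "?ev t = tensor scale (fst (p t)) (snd (p t)) ?h" using p[OF t] by metis
      also have "\<dots> = \<phi> (g t)" using h g(2)[OF t] by (simp add: tensor_def)
      finally show "?ev t = \<phi> (g t)" .
    qed
    moreover have "?ev (tensor scale a b) = \<phi> (f a b)" using h by (simp add: tensor_def)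
    ultimately have "\<phi> ?z = 0"
      by (simp add: D.linear_diff[OF \<phi>(1)])
    with \<phi>(2) show False by simp
  qed
  with g(1) show ?thesis by blast
qed

theorem tensor_universal_unique:
  fixes scale :: "'k::field \<Rightarrow> 'a::ab_group_add \<Rightarrow> 'a"
    and scale' :: "'k \<Rightarrow> 'c::ab_group_add \<Rightarrow> 'c"
  assumes "Vector_Spaces.linear tensor_scale scale' g" "Vector_Spaces.linear tensor_scale scale' h"
    and "\<And>a b. g (tensor scale a b) = h (tensor scale a b)"
    and "t \<in> tensor_space scale"
  shows "g t = h t"
proof -
  interpret T: vector_space_pair "tensor_scale :: 'k \<Rightarrow> ('a, 'k) tensor \<Rightarrow> _" scale'
    using assms(1) by (simp add: vector_space_pair_def Vector_Spaces.linear_iff)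
  show ?thesis
    by (rule T.linear_eq_on[OF assms(1,2) assms(4)[unfolded tensor_space_def]]) (use assms(3) in auto)
qed

lemma tensor_lift:
  assumes "bilinear_map scale scale' f"
  shows "Vector_Spaces.linear tensor_scale scale' (tensor_lift scale scale' f)"
    and "tensor_lift scale scale' f (tensor scale a b) = f a b"
  using someI_ex[OF tensor_universal[OF assms]] unfolding tensor_lift_def by blast+

section \<open>The universal Leibniz envelope\<close>

definition env_scale ::
  "('k::field \<Rightarrow> 'a \<Rightarrow> 'a) \<Rightarrow> 'k \<Rightarrow> 'a \<times> ('a, 'k) tensor \<Rightarrow> 'a \<times> ('a, 'k) tensor" where
  "env_scale scale c u = (scale c (fst u), tensor_scale c (snd u))"

definition env_carrier ::
  "('k::field \<Rightarrow> 'a::ab_group_add \<Rightarrow> 'a) \<Rightarrow> ('a \<times> ('a, 'k) tensor) set" where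
  "env_carrier scale = UNIV \<times> tensor_space scale"

text \<open>The bilinear extension to \<open>env_carrier scale\<close> of the four defining rules: see the theorems
  \<open>env_bracket_rules\<close> and \<open>bracket_algebra_env\<close>.\<close>

definition env_bracket ::
  "('k::field \<Rightarrow> 'a::ab_group_add \<Rightarrow> 'a) \<Rightarrow> ('a \<Rightarrow> 'a \<Rightarrow> 'a \<Rightarrow> 'a)
     \<Rightarrow> 'a \<times> ('a, 'k) tensor \<Rightarrow> 'a \<times> ('a, 'k) tensor \<Rightarrow> 'a \<times> ('a, 'k) tensor" where
  "env_bracket scale tri u v =
    (let a = fst u; s = snd u; c = fst v; t = snd v in
      (tensor_lift scale scale (\<lambda>x y. tri x y c) s
         + tensor_lift scale scale (\<lambda>x y. tri a x y - tri a y x) t,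
       tensor scale a c
         + tensor_lift scale tensor_scale
             (\<lambda>x y. tensor_lift scale tensor_scale
                (\<lambda>z w. tensor scale (tri x y z) w - tensor scale (tri x y w) z) t) s))"

definition env_incl :: "'a \<Rightarrow> 'a \<times> ('a, 'k::field) tensor" where
  "env_incl a = (a, 0)"

context leibniz_triple_system
begin

lemma tri_simps:
  "tri (x + y) b c = tri x b c + tri y b c" "tri a (x + y) c = tri a x c + tri a y c"
  "tri a b (x + y) = tri a b x + tri a b y"
  "tri (r *s x) b c = r *s tri x b c" "tri a (r *s x) c = r *s tri a x c"
  "tri a b (r *s x) = r *s tri a b x"
  using linear_1 linear_2 linear_3 unfolding Vector_Spaces.linear_iff by blast+

lemma tri_zero [simp]: "tri 0 a b = 0" "tri a 0 b = 0" "tri a b 0 = 0"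
  using tri_simps(1)[of 0 0] tri_simps(2)[of _ 0 0] tri_simps(3)[of _ _ 0 0] by simp_all

lemma tri_diff:
  "tri (x - y) b c = tri x b c - tri y b c" "tri a (x - y) c = tri a x c - tri a y c"
  "tri a b (x - y) = tri a b x - tri a b y"
  using tri_simps(1)[of "x - y" y] tri_simps(2)[of _ "x - y" y] tri_simps(3)[of _ _ "x - y" y]
  by (simp_all add: algebra_simps)

sublocale tens: vector_space "tensor_scale :: 'k \<Rightarrow> ('a, 'k) tensor \<Rightarrow> _"
  by (rule vector_space_tensor)

sublocale env: vector_space "env_scale scale"
  by unfold_locales
    (auto simp: env_scale_def scale_right_distrib scale_left_distrib
      tens.scale_right_distrib tens.scale_left_distrib)

abbreviation tn where "tn \<equiv> tensor scale"
abbreviation TS where "TS \<equiv> tensor_space scale"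
abbreviation br where "br \<equiv> env_bracket scale tri"

lemmas tensor_simps = bilinear_mapD[OF bilinear_tensor[OF vector_space_axioms]]

lemma tensor_diff: "tn (x - y) z = tn x z - tn y z" "tn z (x - y) = tn z x - tn z y"
  using tensor_simps(1)[of "x - y" y] tensor_simps(3)[of _ "x - y" y] by (simp_all add: algebra_simps)

lemma subspace_TS: "tens.subspace TS"
  by (simp add: tensor_space_def)

lemma tensor_in_TS [simp]: "tn a b \<in> TS"
  by (auto simp: tensor_space_def intro: tens.span_base)

lemma TS_closed [simp]:
  "0 \<in> TS" "s \<in> TS \<Longrightarrow> t \<in> TS \<Longrightarrow> s + t \<in> TS" "s \<in> TS \<Longrightarrow> t \<in> TS \<Longrightarrow> s - t \<in> TS"
  "s \<in> TS \<Longrightarrow> tensor_scale c s \<in> TS"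
  using subspace_TS tens.subspace_0 tens.subspace_add tens.subspace_diff tens.subspace_scale by blast+

text \<open>Tensors are functions, but should not be expanded pointwise.\<close>

declare plus_fun_apply [simp del] zero_fun_apply [simp del] minus_apply [simp del]

lemma TS_induct [consumes 1, case_names tensor zero add scale]:
  assumes t: "t \<in> TS" and P: "\<And>a b. P (tn a b)" "P 0" "\<And>s t. P s \<Longrightarrow> P t \<Longrightarrow> P (s + t)"
    "\<And>c t. P t \<Longrightarrow> P (tensor_scale c t)"
  shows "P t"
proof -
  have "tens.subspace (Collect P)" by (rule tens.subspaceI) (use P in auto)
  then have "TS \<subseteq> Collect P"
    unfolding tensor_space_def by (intro tens.span_minimal) (use P in auto)
  with t show ?thesis by blast
qed

lemma lift_simps:
  assumes "bilinear_map scale s' f"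
  shows "tensor_lift scale s' f (s + t) = tensor_lift scale s' f s + tensor_lift scale s' f t"
    and "tensor_lift scale s' f (tensor_scale c t) = s' c (tensor_lift scale s' f t)"
    and "tensor_lift scale s' f 0 = 0"
    and "tensor_lift scale s' f (s - t) = tensor_lift scale s' f s - tensor_lift scale s' f t"
proof -
  have l: "Vector_Spaces.linear tensor_scale s' (tensor_lift scale s' f)"
    by (rule tensor_lift(1)[OF assms])
  show 1: "tensor_lift scale s' f (s + t) = tensor_lift scale s' f s + tensor_lift scale s' f t" for s t
    using l unfolding Vector_Spaces.linear_iff by blast
  show "tensor_lift scale s' f (tensor_scale c t) = s' c (tensor_lift scale s' f t)"
    using l unfolding Vector_Spaces.linear_iff by blast
  show "tensor_lift scale s' f 0 = 0" using 1[of 0 0] by simp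
  show "tensor_lift scale s' f (s - t) = tensor_lift scale s' f s - tensor_lift scale s' f t"
    using 1[of "s - t" t] by (simp add: algebra_simps)
qed

lemma lift_in_TS:
  assumes "bilinear_map scale tensor_scale f" "\<And>x y. f x y \<in> TS" "t \<in> TS"
  shows "tensor_lift scale tensor_scale f t \<in> TS"
  using assms(3) by (induction rule: TS_induct) (use assms in \<open>auto simp: lift_simps tensor_lift(2)\<close>)

text \<open>The components of the bracket, each linear in a tensor argument.\<close>

definition "brP c = tensor_lift scale scale (\<lambda>x y. tri x y c)"
definition "brQ a = tensor_lift scale scale (\<lambda>x y. tri a x y - tri a y x)"
definition
  "brI x y = tensor_lift scale tensor_scale (\<lambda>z w. tn (tri x y z) w - tn (tri x y w) z)"
definition "brR t = tensor_lift scale tensor_scale (\<lambda>x y. brI x y t)"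

lemma env_scale_Pair: "env_scale scale c (a, t) = (c *s a, tensor_scale c t)"
  by (simp add: env_scale_def)

lemma br_eq: "br (a, s) (c, t) = (brP c s + brQ a t, tn a c + brR t s)"
  by (simp add: env_bracket_def brP_def brQ_def brI_def brR_def)

lemma bil_P: "bilinear_map scale scale (\<lambda>x y. tri x y c)"
  by (rule bilinear_mapI[OF vector_space_axioms vector_space_axioms]) (auto simp: tri_simps)

lemma bil_Q: "bilinear_map scale scale (\<lambda>x y. tri a x y - tri a y x)"
  by (rule bilinear_mapI[OF vector_space_axioms vector_space_axioms])
    (auto simp: tri_simps algebra_simps)

lemma bil_I: "bilinear_map scale tensor_scale (\<lambda>z w. tn (tri x y z) w - tn (tri x y w) z)"
  by (rule bilinear_mapI[OF vector_space_axioms vector_space_tensor])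
    (auto simp: tri_simps tensor_simps tens.scale_right_diff_distrib)

lemmas P_simps =
  lift_simps[OF bil_P, folded brP_def] tensor_lift(2)[OF bil_P, folded brP_def]
lemmas Q_simps =
  lift_simps[OF bil_Q, folded brQ_def] tensor_lift(2)[OF bil_Q, folded brQ_def]
lemmas I_simps =
  lift_simps[OF bil_I, folded brI_def] tensor_lift(2)[OF bil_I, folded brI_def]

lemma I_in_TS: "t \<in> TS \<Longrightarrow> brI x y t \<in> TS"
  unfolding brI_def by (rule lift_in_TS[OF bil_I]) auto

lemma bil_R:
  assumes "t \<in> TS"
  shows "bilinear_map scale tensor_scale (\<lambda>x y. brI x y t)"
proof (rule bilinear_mapI[OF vector_space_axioms vector_space_tensor])
  show "brI (x + x') y t = brI x y t + brI x' y t" for x x' y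
    using assms by (induction rule: TS_induct)
      (auto simp: I_simps tri_simps tensor_simps tens.scale_right_distrib)
  show "brI x (y + y') t = brI x y t + brI x y' t" for x y' y
    using assms by (induction rule: TS_induct)
      (auto simp: I_simps tri_simps tensor_simps tens.scale_right_distrib)
  show "brI (c *s x) y t = tensor_scale c (brI x y t)" for x y c
    using assms by (induction rule: TS_induct)
      (auto simp: I_simps tri_simps tensor_simps tens.scale_right_diff_distrib
        tens.scale_right_distrib tens.scale_left_commute)
  show "brI x (c *s y) t = tensor_scale c (brI x y t)" for x y c
    using assms by (induction rule: TS_induct)
      (auto simp: I_simps tri_simps tensor_simps tens.scale_right_diff_distrib
        tens.scale_right_distrib tens.scale_left_commute)
qed

lemmas R_simps =
  lift_simps[OF bil_R, folded brR_def] tensor_lift(2)[OF bil_R, folded brR_def]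

lemma R_in_TS: "s \<in> TS \<Longrightarrow> t \<in> TS \<Longrightarrow> brR t s \<in> TS"
  unfolding brR_def by (rule lift_in_TS[OF bil_R]) (auto intro: I_in_TS)

lemma P_index:
  assumes "s \<in> TS"
  shows "brP (c + d) s = brP c s + brP d s" "brP (r *s c) s = r *s brP c s"
  by (use assms in \<open>induction rule: TS_induct; auto simp: P_simps tri_simps scale_right_distrib scale_left_commute\<close>)+

lemma Q_index:
  assumes "t \<in> TS"
  shows "brQ (a + b) t = brQ a t + brQ b t" "brQ (r *s a) t = r *s brQ a t"
  by (use assms in \<open>induction rule: TS_induct; auto simp: Q_simps tri_simps scale_right_distrib scale_right_diff_distrib scale_left_commute\<close>)+

lemma R_index:
  assumes "s \<in> TS" "t \<in> TS"
  shows "t' \<in> TS \<Longrightarrow> brR (t + t') s = brR t s + brR t' s"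
    and "brR (tensor_scale r t) s = tensor_scale r (brR t s)"
proof -
  show "brR (t + t') s = brR t s + brR t' s" if "t' \<in> TS"
    using assms(1) by (induction rule: TS_induct)
      (use assms(2) that in \<open>auto simp: R_simps I_simps tens.scale_right_distrib\<close>)
  show "brR (tensor_scale r t) s = tensor_scale r (brR t s)"
    using assms(1) by (induction rule: TS_induct)
      (use assms(2) in \<open>auto simp: R_simps I_simps tens.scale_right_distrib tens.scale_left_commute\<close>)
qed

lemma zero_index [simp]: "t \<in> TS \<Longrightarrow> brP 0 t = 0" "t \<in> TS \<Longrightarrow> brQ 0 t = 0"
  "t \<in> TS \<Longrightarrow> brR 0 t = 0" "tn 0 a = 0" "tn a 0 = 0"
  using P_index(1)[of t 0 0] Q_index(1)[of t 0 0] R_index(1)[of t 0 0]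
    tensor_simps(1)[of 0 0 a] tensor_simps(3)[of a 0 0] by auto

theorem env_bracket_rules:
  "br (a, 0) (b, 0) = (0, tn a b)"
  "br (0, tn a b) (c, 0) = (tri a b c, 0)"
  "br (a, 0) (0, tn b c) = (tri a b c - tri a c b, 0)"
  "br (0, tn a b) (0, tn c d) = (0, tn (tri a b c) d - tn (tri a b d) c)"
  by (simp_all add: br_eq P_simps Q_simps R_simps I_simps)

theorem bracket_algebra_env:
  "bracket_algebra (env_scale scale) (env_carrier scale) br"
proof
  let ?L = "env_carrier scale" and ?s = "env_scale scale"
  let ?G = "range (\<lambda>a. (a, 0)) \<union> {(0, tn a b) | a b. True}"
  show sub: "env.subspace ?L"
    by (rule env.subspaceI) (auto simp: env_carrier_def env_scale_def zero_prod_def)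
  show closed: "br x y \<in> ?L" if "x \<in> ?L" "y \<in> ?L" for x y
    using that by (cases x; cases y) (auto simp: env_carrier_def br_eq intro!: R_in_TS TS_closed)
  show addl: "br (x + y) z = br x z + br y z" if "x \<in> ?L" "y \<in> ?L" "z \<in> ?L" for x y z
    using that by (cases x; cases y; cases z)
      (auto simp: env_carrier_def br_eq P_simps Q_index R_simps tensor_simps)
  show addr: "br x (y + z) = br x y + br x z" if "x \<in> ?L" "y \<in> ?L" "z \<in> ?L" for x y z
    using that by (cases x; cases y; cases z)
      (auto simp: env_carrier_def br_eq Q_simps P_index R_index tensor_simps)
  show scl: "br (?s c x) y = ?s c (br x y)" if "x \<in> ?L" "y \<in> ?L" for c x y
    using that by (cases x; cases y)
      (auto simp: env_carrier_def env_scale_def br_eq P_simps Q_index R_simps tensor_simps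
        scale_right_distrib tens.scale_right_distrib)
  show scr: "br x (?s c y) = ?s c (br x y)" if "x \<in> ?L" "y \<in> ?L" for c x y
    using that by (cases x; cases y)
      (auto simp: env_carrier_def env_scale_def br_eq Q_simps P_index R_index tensor_simps
        scale_right_distrib tens.scale_right_distrib)
  have genL: "x \<in> env.span ?G" if xL: "x \<in> ?L" for x
  proof -
    obtain a t where x: "x = (a, t)" "t \<in> TS"
      using xL by (cases x) (auto simp: env_carrier_def)
    have "(0, t) \<in> env.span ?G"
    using x(2)
    proof (induction rule: TS_induct)
      show "(0, tn a b) \<in> env.span ?G" for a b by (rule env.span_base) auto
      show "(0, 0) \<in> env.span ?G" using env.span_zero by (simp add: zero_prod_def)
      show "(0, s + t) \<in> env.span ?G" if "(0, s) \<in> env.span ?G" "(0, t) \<in> env.span ?G" for s t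
        using env.span_add[OF that] by simp
      show "(0, tensor_scale c t) \<in> env.span ?G" if "(0, t) \<in> env.span ?G" for c t
        using env.span_scale[OF that, of c] by (simp add: env_scale_Pair)
    qed
    moreover have "(a, 0) \<in> env.span ?G" by (rule env.span_base) auto
    ultimately show ?thesis using env.span_add[of "(a, 0)" ?G "(0, t)"] x by simp
  qed
  show "\<exists>B. finite B \<and> env.span B = ?L"
  proof -
    obtain B where B: "finite B" "span B = UNIV" using finite_dim by blast
    let ?C = "(\<lambda>a. (a, 0)) ` B \<union> (\<lambda>(a, b). (0, tn a b)) ` (B \<times> B)"
    have 1: "(a, 0) \<in> env.span ?C" for a
    proof -
      have "a \<in> span B" using B by simp
      then show ?thesis
      proof (induction rule: span_induct_alt)
        case base then show ?case using env.span_zero by (simp add: zero_prod_def)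
      next
        case (step c x y)
        have "(x, 0) \<in> env.span ?C" using step by (intro env.span_base) auto
        from env.span_add[OF env.span_scale[OF this, of c] step(2)] show ?case
          by (simp add: env_scale_Pair)
      qed
    qed
    have 2: "(0, tn a b) \<in> env.span ?C" if "b \<in> B" for a b
    proof -
      have "a \<in> span B" using B by simp
      then show ?thesis
      proof (induction rule: span_induct_alt)
        case base then show ?case using env.span_zero by (simp add: zero_prod_def)
      next
        case (step c x y)
        have "(0, tn x b) \<in> env.span ?C" using step that by (intro env.span_base) auto
        from env.span_add[OF env.span_scale[OF this, of c] step(2)] show ?case
          by (simp add: env_scale_Pair tensor_simps)
      qed
    qed
    have 3: "(0, tn a b) \<in> env.span ?C" for a b
    proof -
      have "b \<in> span B" using B by simp
      then show ?thesis
      proof (induction rule: span_induct_alt)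
        case base then show ?case using env.span_zero by (simp add: zero_prod_def)
      next
        case (step c x y)
        from env.span_add[OF env.span_scale[OF 2[OF step(1), of a], of c] step(2)] show ?case
          by (simp add: env_scale_Pair tensor_simps)
      qed
    qed
    have "env.span ?C \<subseteq> ?L" by (rule env.span_minimal[OF _ sub]) (auto simp: env_carrier_def)
    moreover have "?G \<subseteq> env.span ?C" using 1 3 by auto
    then have "env.span ?G \<subseteq> env.span ?C" by (rule env.span_minimal) simp
    then have "?L \<subseteq> env.span ?C" using genL by blast
    ultimately show ?thesis using B(1) by (intro exI[of _ ?C]) auto
  qed
qed

end

end

theory Submission
  imports Defs
begin

text \<open>If \<open>I\<close> is a nilpotent ideal of \<open>T\<close>, then \<open>I \<oplus> (I \<otimes> T + T \<otimes> I)\<close> is a nilpotent ideal of \<open>U(T)\<close>,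
  which gives \<open>N(T) \<subseteq> Nil(U(T))\<close>. Conversely, let \<open>V\<close> be a nilpotent ideal of \<open>U(T)\<close> and
  \<open>K = V \<inter> T\<close>. The bracket need not satisfy the Leibniz identity, but for a third argument in \<open>T\<close> it
  does so modulo \<open>Z = {s \<in> T \<otimes> T. [s, T] = 0}\<close>, and \<open>[Z, U(T)] = 0\<close>. Filter \<open>U(T)\<close> by
  \<open>F\<^sub>0 = U(T)\<close> and \<open>F\<^sub>n\<^sub>+\<^sub>1 = V\<^sup>n + Z\<close>. Right multiplication by an element of \<open>T\<close> preserves the
  filtration, by an element of \<open>K\<close> it raises the filtration degree by \<open>1\<close>, and by the Leibniz identity
  these degrees add up under the triple product. Hence \<open>K\<^sup>n \<subseteq> F\<^sub>n\<^sub>+\<^sub>1\<close>. If \<open>V\<^sup>n = 0\<close>, then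
  \<open>F\<^sub>n\<^sub>+\<^sub>1 = Z\<close> meets \<open>T\<close> trivially, so \<open>K\<^sup>n = 0\<close>.\<close>

context leibniz_triple_system
begin

sublocale U: bracket_algebra "env_scale scale" "env_carrier scale" br
  by (rule bracket_algebra_env)

section \<open>Products of ideals of a Leibniz triple system\<close>

lemma span_plus_span: "span A + span B = span (A \<union> B)"
  by (auto simp: span_Un set_plus_def)

lemma ideal_iff:
  "ideal I \<longleftrightarrow> subspace I \<and> (\<forall>x\<in>I. \<forall>u v. tri x u v \<in> I \<and> tri u x v \<in> I \<and> tri u v x \<in> I)"
proof (cases "subspace I")
  case True
  have span: "span A \<subseteq> I \<longleftrightarrow> A \<subseteq> I" for A
    using span_minimal[OF _ True, of A] span_superset[of A] by blast
  show ?thesis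
    unfolding ideal_def tri_span_def span_plus_span span Un_subset_iff using True by blast
qed (simp add: ideal_def)

lemma idealD:
  assumes "ideal I"
  shows "subspace I" "x \<in> I \<Longrightarrow> tri x u v \<in> I" "x \<in> I \<Longrightarrow> tri u x v \<in> I" "x \<in> I \<Longrightarrow> tri u v x \<in> I"
  using assms by (auto simp: ideal_iff)

text \<open>The recursion step of \<open>ideal_power\<close> with the power replaced by an arbitrary
  second set. Symmetry in \<open>I\<close> and \<open>J\<close> halves the case distinctions
  below.\<close>

definition tri_product :: "'a set \<Rightarrow> 'a set \<Rightarrow> 'a set" where
  "tri_product I J = span {tri a b c | a b c.
     a \<in> I \<and> b \<in> J \<or> a \<in> I \<and> c \<in> J \<or> b \<in> I \<and> c \<in> J \<or>
     a \<in> J \<and> b \<in> I \<or> a \<in> J \<and> c \<in> I \<or> b \<in> J \<and> c \<in> I}"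

lemma ideal_power_Suc: "ideal_power I (Suc n) = tri_product (ideal_power I n) I"
  unfolding ideal_power.simps tri_span_def span_plus_span tri_product_def
  by (rule arg_cong[where f = span]) blast

lemma tri_product_commute: "tri_product I J = tri_product J I"
  unfolding tri_product_def by (rule arg_cong[where f = span]) blast

lemma tri_productI:
  "a \<in> I \<Longrightarrow> b \<in> J \<Longrightarrow> tri a b c \<in> tri_product I J"
  "a \<in> I \<Longrightarrow> c \<in> J \<Longrightarrow> tri a b c \<in> tri_product I J"
  "b \<in> I \<Longrightarrow> c \<in> J \<Longrightarrow> tri a b c \<in> tri_product I J"
  "a \<in> J \<Longrightarrow> b \<in> I \<Longrightarrow> tri a b c \<in> tri_product I J"
  "a \<in> J \<Longrightarrow> c \<in> I \<Longrightarrow> tri a b c \<in> tri_product I J"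
  "b \<in> J \<Longrightarrow> c \<in> I \<Longrightarrow> tri a b c \<in> tri_product I J"
  unfolding tri_product_def by (rule span_base; blast)+

lemma subspace_tri_product: "subspace (tri_product I J)"
  by (simp add: tri_product_def)

lemma tri_product_minimal:
  assumes "subspace S" and "\<And>a b c. a \<in> I \<and> b \<in> J \<or> a \<in> I \<and> c \<in> J \<or> b \<in> I \<and> c \<in> J \<or>
     a \<in> J \<and> b \<in> I \<or> a \<in> J \<and> c \<in> I \<or> b \<in> J \<and> c \<in> I \<Longrightarrow> tri a b c \<in> S"
  shows "tri_product I J \<subseteq> S"
  unfolding tri_product_def using assms by (intro span_minimal) blast+

text \<open>Solve \<open>lts_right\<close> for \<open>{{abc}de}\<close>: every other term has
  \<open>{ab_}\<close> in \<open>I\<close> with \<open>c\<close> in \<open>J\<close> beside it, or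
  \<open>{cde}\<close> in \<open>J\<close> beside \<open>a\<close> and \<open>b\<close>.\<close>

lemma tri_word_1:
  assumes I: "ideal I" and J: "ideal J" and "a \<in> I \<or> b \<in> I" "c \<in> J"
  shows "tri (tri a b c) d e \<in> tri_product I J"
proof -
  have I': "tri a b x \<in> I" for x using assms idealD[OF I] by blast
  have "tri (tri a b c) d e = tri a b (tri c d e) + tri (tri a b d) c e + tri (tri a b e) c d
      - tri (tri a b e) d c"
    using lts_right[of a b c d e] by simp
  moreover have "tri a b (tri c d e) \<in> tri_product I J"
    using assms idealD(2)[OF J] by (blast intro: tri_productI)
  ultimately show ?thesis
    using I' \<open>c \<in> J\<close> subspace_tri_product
    by (auto intro!: subspace_diff subspace_add intro: tri_productI)
qed

text \<open>Solving \<open>lts_middle\<close> for \<open>{{abc}de}\<close> moves \<open>b\<close> to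
  the third inner slot, where \<open>tri_word_1\<close> applies, or puts a factor from
  \<open>I\<close> and one from \<open>J\<close> side by side.\<close>

lemma tri_word_2:
  assumes I: "ideal I" and J: "ideal J" and "a \<in> I" "b \<in> J"
  shows "tri (tri a b c) d e \<in> tri_product I J"
proof -
  have "tri (tri a b c) d e = tri a (tri b c d) e + tri (tri a c b) d e + tri (tri a d b) c e
      - tri (tri a d c) b e"
    using lts_middle[of a b c d e] by simp
  then show ?thesis
    using assms idealD(2)[OF I, of a] idealD(2)[OF J, of b] tri_word_1[OF I J] subspace_tri_product
    by (auto intro!: subspace_diff subspace_add intro: tri_productI)
qed

lemma tri_word:
  assumes I: "ideal I" and J: "ideal J"
    and "a \<in> I \<and> b \<in> J \<or> a \<in> I \<and> c \<in> J \<or> b \<in> I \<and> c \<in> J \<or>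
         a \<in> J \<and> b \<in> I \<or> a \<in> J \<and> c \<in> I \<or> b \<in> J \<and> c \<in> I"
  shows "tri (tri a b c) d e \<in> tri_product I J"
  using assms(3) tri_word_1[OF I J] tri_word_1[OF J I] tri_word_2[OF I J] tri_word_2[OF J I]
  unfolding tri_product_commute[of J I] by blast

lemma tri_word_outer:
  assumes I: "ideal I" and J: "ideal J"
    and "x \<in> I \<and> y \<in> J \<or> x \<in> J \<and> y \<in> I"
  shows "x \<in> {a, b, c} \<Longrightarrow> y \<in> {d, e} \<Longrightarrow> tri (tri a b c) d e \<in> tri_product I J"
  using assms(3) idealD(2-4)[OF I] idealD(2-4)[OF J] by (auto intro: tri_productI)

text \<open>In the left slot a generator \<open>{abc}\<close> gives a left-normed word; in the other
  slots \<open>lts_middle\<close> and \<open>lts_right\<close> expand into such words. The two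
  distinguished factors are then both inner (\<open>tri_word\<close>), one inner and one outer
  (\<open>tri_word_outer\<close>), or both outer.\<close>

lemma ideal_tri_product:
  assumes I: "ideal I" and J: "ideal J"
  shows "ideal (tri_product I J)"
  unfolding ideal_iff
proof (intro conjI ballI allI)
  let ?P = "tri_product I J"
  show S: "subspace ?P" by (rule subspace_tri_product)
  fix x u v assume x: "x \<in> ?P"
  have "?P \<subseteq> {x. tri x u v \<in> ?P}"
    by (rule tri_product_minimal) (use tri_word[OF I J] S in
      \<open>auto simp: subspace_def tri_simps\<close>)
  then show "tri x u v \<in> ?P" using x by blast
  have "?P \<subseteq> {x. tri u x v \<in> ?P}"
  proof (rule tri_product_minimal)
    fix a b c assume "a \<in> I \<and> b \<in> J \<or> a \<in> I \<and> c \<in> J \<or> b \<in> I \<and> c \<in> J \<or>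
         a \<in> J \<and> b \<in> I \<or> a \<in> J \<and> c \<in> I \<or> b \<in> J \<and> c \<in> I"
    then have "tri (tri u a b) c v \<in> ?P" "tri (tri u b a) c v \<in> ?P"
        "tri (tri u c a) b v \<in> ?P" "tri (tri u c b) a v \<in> ?P"
      using tri_word[OF I J] tri_word_outer[OF I J] by blast+
    then show "tri a b c \<in> {x. tri u x v \<in> ?P}"
      using S by (auto simp: lts_middle intro!: subspace_diff subspace_add)
  qed (use S in \<open>auto simp: subspace_def tri_simps\<close>)
  then show "tri u x v \<in> ?P" using x by blast
  have "?P \<subseteq> {x. tri u v x \<in> ?P}"
  proof (rule tri_product_minimal)
    fix a b c assume "a \<in> I \<and> b \<in> J \<or> a \<in> I \<and> c \<in> J \<or> b \<in> I \<and> c \<in> J \<or>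
         a \<in> J \<and> b \<in> I \<or> a \<in> J \<and> c \<in> I \<or> b \<in> J \<and> c \<in> I"
    then have "tri (tri u v a) b c \<in> ?P" "tri (tri u v b) a c \<in> ?P"
        "tri (tri u v c) a b \<in> ?P" "tri (tri u v c) b a \<in> ?P"
      using tri_word_outer[OF I J] idealD(4)[OF I] idealD(4)[OF J]
      by (blast intro: tri_productI)+
    then show "tri a b c \<in> {x. tri u v x \<in> ?P}"
      using S by (auto simp: lts_right intro!: subspace_diff subspace_add)
  qed (use S in \<open>auto simp: subspace_def tri_simps\<close>)
  then show "tri u v x \<in> ?P" using x by blast
qed

lemma ideal_ideal_power: "ideal I \<Longrightarrow> ideal (ideal_power I n)"
  by (induction n) (simp_all add: ideal_power_Suc ideal_tri_product del: ideal_power.simps(2))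

section \<open>The ideal of the envelope generated by an ideal\<close>

text \<open>Indexing by a relation covers spaces such as
  \<open>I \<otimes> T + T \<otimes> I\<close>, which are not given as a product of two
  subspaces.\<close>

definition tensors :: "('a \<Rightarrow> 'a \<Rightarrow> bool) \<Rightarrow> ('a, 'k) tensor set" where
  "tensors G = tens.span {tn a b | a b. G a b}"

lemma tensorsI: "G a b \<Longrightarrow> tn a b \<in> tensors G"
  unfolding tensors_def by (rule tens.span_base) blast

lemma subspace_tensors: "tens.subspace (tensors G)"
  by (simp add: tensors_def)

lemma tensors_subset_TS: "tensors G \<subseteq> TS"
  unfolding tensors_def by (rule tens.span_minimal[OF _ subspace_TS]) auto

text \<open>The closure steps carry membership in \<open>TS\<close> because \<open>R_index\<close>
  gives additivity of \<open>brR\<close> in its index only inside \<open>TS\<close>.\<close>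

lemma tensors_induct [consumes 1, case_names tensor zero add scale]:
  assumes t: "t \<in> tensors G" and P: "\<And>a b. G a b \<Longrightarrow> P (tn a b)" "P 0"
    "\<And>s t. s \<in> TS \<Longrightarrow> t \<in> TS \<Longrightarrow> P s \<Longrightarrow> P t \<Longrightarrow> P (s + t)"
    "\<And>c t. t \<in> TS \<Longrightarrow> P t \<Longrightarrow> P (tensor_scale c t)"
  shows "P t"
proof -
  have "tens.subspace {t \<in> TS. P t}" by (rule tens.subspaceI) (use P in auto)
  then have "tensors G \<subseteq> {t \<in> TS. P t}"
    unfolding tensors_def by (intro tens.span_minimal) (use P in auto)
  with t show ?thesis by blast
qed

lemma subspace_Times:
  assumes "subspace A" "tens.subspace B"
  shows "env.subspace (A \<times> B)"
  using assms by (auto simp: env.subspace_def subspace_def tens.subspace_def env_scale_def zero_prod_def)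

text \<open>The bracket is built from lifts of bilinear maps, so it is controlled by its values on
  pure tensors: the last four hypotheses correspond to the four rules of
  \<open>env_bracket_rules\<close>.\<close>

lemma br_span_graded:
  assumes A: "subspace A''"
    and AA: "\<And>a b. a \<in> A \<Longrightarrow> b \<in> A' \<Longrightarrow> G'' a b"
    and AG: "\<And>a b c. a \<in> A \<Longrightarrow> G' b c \<Longrightarrow> tri a b c - tri a c b \<in> A''"
    and GA: "\<And>a b c. G a b \<Longrightarrow> c \<in> A' \<Longrightarrow> tri a b c \<in> A''"
    and GG: "\<And>a b c d. G a b \<Longrightarrow> G' c d \<Longrightarrow>
      tn (tri a b c) d - tn (tri a b d) c \<in> tensors G''"
  shows "U.br_span (A \<times> tensors G) (A' \<times> tensors G') \<subseteq> A'' \<times> tensors G''"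
proof -
  note T = subspace_tensors[of G'']
  have 1: "brP c s \<in> A''" if "s \<in> tensors G" "c \<in> A'" for s c
    using that(1) by (induction rule: tensors_induct)
      (use that(2) GA A in \<open>auto simp: P_simps subspace_0 subspace_add subspace_scale\<close>)
  have 2: "brQ a t \<in> A''" if "t \<in> tensors G'" "a \<in> A" for t a
    using that(1) by (induction rule: tensors_induct)
      (use that(2) AG A in \<open>auto simp: Q_simps subspace_0 subspace_add subspace_scale\<close>)
  have 3: "brI a b t \<in> tensors G''" if "t \<in> tensors G'" "G a b" for a b t
    using that(1) by (induction rule: tensors_induct)
      (use that(2) GG T in \<open>auto simp: I_simps tens.subspace_0 tens.subspace_add tens.subspace_scale\<close>)
  have 4: "brR t s \<in> tensors G''" if "s \<in> tensors G" "t \<in> tensors G'" for s t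
    using that(1) by (induction rule: tensors_induct)
      (use that(2) tensors_subset_TS 3 T in
        \<open>auto simp: R_simps tens.subspace_0 tens.subspace_add tens.subspace_scale subset_iff\<close>)
  have "br (a, s) (c, t) \<in> A'' \<times> tensors G''"
    if "a \<in> A" "s \<in> tensors G" "c \<in> A'" "t \<in> tensors G'" for a s c t
    using that 1 2 4 A T tensorsI[of G'', OF AA] by (auto simp: br_eq subspace_add tens.subspace_add)
  then show ?thesis
    unfolding U.br_span_def by (intro env.span_minimal subspace_Times A T) blast
qed

definition env_ideal :: "'a set \<Rightarrow> ('a \<times> ('a, 'k) tensor) set" where
  "env_ideal I = I \<times> tensors (\<lambda>a b. a \<in> I \<or> b \<in> I)"

lemma env_carrier_eq: "env_carrier scale = UNIV \<times> tensors (\<lambda>_ _. True)"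
  by (simp add: env_carrier_def tensor_space_def tensors_def)

lemma ideal_env_ideal:
  assumes I: "ideal I"
  shows "U.ideal (env_ideal I)"
  unfolding U.ideal_def unfolding env_carrier_eq env_ideal_def
proof (intro conjI)
  note [simp] = idealD(2-4)[OF I]
  note [intro!] = tens.subspace_diff[OF subspace_tensors] subspace_diff[OF idealD(1)[OF I]] tensorsI
  let ?G = "\<lambda>a b. a \<in> I \<or> b \<in> I"
  show "env.subspace (I \<times> tensors ?G)"
    by (intro subspace_Times idealD(1)[OF I] subspace_tensors)
  show "I \<times> tensors ?G \<subseteq> UNIV \<times> tensors (\<lambda>_ _. True)"
    using env_carrier_eq env_carrier_def tensors_subset_TS by blast
  show "U.br_span (I \<times> tensors ?G) (UNIV \<times> tensors (\<lambda>_ _. True)) \<subseteq> I \<times> tensors ?G"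
    by (rule br_span_graded[OF idealD(1)[OF I]]) auto
  show "U.br_span (UNIV \<times> tensors (\<lambda>_ _. True)) (I \<times> tensors ?G) \<subseteq> I \<times> tensors ?G"
    by (rule br_span_graded[OF idealD(1)[OF I]]) auto
qed

section \<open>Nilpotency of the generated ideal\<close>

lemma br_span_mono: "A \<subseteq> A' \<Longrightarrow> B \<subseteq> B' \<Longrightarrow> U.br_span A B \<subseteq> U.br_span A' B'"
  unfolding U.br_span_def by (rule env.span_mono) blast

text \<open>One step of the lower series leaves the tensors \<open>I\<^sup>k \<otimes> I\<close> behind, which only a second step moves
  into \<open>I\<^sup>k\<^sup>+\<^sup>1\<close>; hence the factor \<open>2\<close>.\<close>

lemma ideal_power_env_ideal:
  assumes I: "ideal I"
  shows "U.ideal_power (env_ideal I) (2 * k) \<subseteq> env_ideal (ideal_power I k)"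
proof (induction k)
  case 0
  show ?case by simp
next
  case (Suc k)
  let ?V = "env_ideal I" and ?J = "ideal_power I k" and ?J' = "ideal_power I (Suc k)"
  let ?H = "?J' \<times> tensors (\<lambda>a b. a \<in> ?J' \<or> b \<in> ?J' \<or> a \<in> ?J \<and> b \<in> I)"
  note J = ideal_ideal_power[OF I, of k] and J' = ideal_ideal_power[OF I, of "Suc k"]
  note [simp] = idealD(2-4)[OF I] idealD(2-4)[OF J] idealD(2-4)[OF J']
  note P = tri_productI[of _ ?J _ I, folded ideal_power_Suc]
  note [intro!] = tens.subspace_diff[OF subspace_tensors] subspace_diff[OF idealD(1)[OF J']] tensorsI
  have 1: "U.br_span (env_ideal ?J) ?V \<subseteq> ?H"
    unfolding env_ideal_def
    by (rule br_span_graded[OF idealD(1)[OF J']]) (auto simp: P simp del: ideal_power.simps(2))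
  have 2: "U.br_span ?H ?V \<subseteq> env_ideal ?J'"
    unfolding env_ideal_def
    by (rule br_span_graded[OF idealD(1)[OF J']]) (auto simp: P simp del: ideal_power.simps(2))
  have "U.ideal_power ?V (Suc (Suc (2 * k))) \<subseteq> U.br_span (U.br_span (env_ideal ?J) ?V) ?V"
    unfolding U.ideal_power.simps using Suc.IH by (intro br_span_mono order_refl)
  also have "\<dots> \<subseteq> U.br_span ?H ?V" using 1 by (rule br_span_mono) simp
  finally show ?case using 2 by simp
qed

lemma zero_in_ideal_power: "U.ideal V \<Longrightarrow> 0 \<in> U.ideal_power V n"
  by (cases n) (auto simp: U.ideal_def U.br_span_def env.subspace_0 env.span_zero)

lemma nilpotent_env_ideal:
  assumes "nilpotent_ideal I"
  shows "U.nilpotent_ideal (env_ideal I)"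
proof -
  obtain n where I: "ideal I" and n: "ideal_power I n = {0}"
    using assms by (auto simp: nilpotent_ideal_def)
  \<comment> \<open>Pure tensors with a zero factor vanish.\<close>
  have "tensors (\<lambda>a b. a \<in> {0} \<or> b \<in> {0}) \<subseteq> {0}"
    unfolding tensors_def by (rule tens.span_minimal) auto
  then have "env_ideal {0} \<subseteq> {0}" by (auto simp: env_ideal_def zero_prod_def)
  then have "U.ideal_power (env_ideal I) (2 * n) \<subseteq> {0}"
    using ideal_power_env_ideal[OF I, of n] n by auto
  then have "U.ideal_power (env_ideal I) (2 * n) = {0}"
    using zero_in_ideal_power[OF ideal_env_ideal[OF I]] by blast
  then show ?thesis using ideal_env_ideal[OF I] unfolding U.nilpotent_ideal_def by blast
qed

lemma env_ideal_incl: "subspace I \<Longrightarrow> a \<in> I \<Longrightarrow> (a, 0) \<in> env_ideal I"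
  using subspace_tensors tens.subspace_0 by (auto simp: env_ideal_def)

section \<open>The Leibniz identity modulo an annihilator\<close>

definition tensor_annihilator :: "('a \<times> ('a, 'k) tensor) set" where
  "tensor_annihilator = {0} \<times> {s \<in> TS. \<forall>c. brP c s = 0}"

lemma tensor_annihilator_subset: "tensor_annihilator \<subseteq> env_carrier scale"
  by (auto simp: tensor_annihilator_def env_carrier_def)

lemma subspace_tensor_annihilator: "env.subspace tensor_annihilator"
  unfolding tensor_annihilator_def
  by (rule subspace_Times) (auto simp: tens.subspace_def P_simps)

text \<open>Makes \<open>[r, T \<otimes> T]\<close> depend only on \<open>[r, T]\<close>, so a
  tensor whose brackets with \<open>T\<close> vanish brackets to zero with the whole envelope. In
  bracket notation:
  \<open>[r, x \<otimes> y] = [r, x] \<otimes> y - [r, y] \<otimes> x\<close>.\<close>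

lemma brR_tensor:
  assumes "r \<in> TS"
  shows "brR (tn x y) r = tn (brP x r) y - tn (brP y r) x"
  using assms by (induction rule: TS_induct)
    (auto simp: R_simps I_simps P_simps tensor_simps tens.scale_right_diff_distrib)

lemma TS_eq_tensors: "TS = tensors (\<lambda>_ _. True)"
  by (simp add: tensor_space_def tensors_def)

lemma br_tensor_annihilator:
  assumes "z \<in> tensor_annihilator" "u \<in> env_carrier scale"
  shows "br z u = 0"
proof -
  obtain s where z: "z = (0, s)" and s: "s \<in> TS" "\<And>c. brP c s = 0"
    using assms(1) by (auto simp: tensor_annihilator_def)
  obtain c t where u: "u = (c, t)" and t: "t \<in> TS"
    using assms(2) by (cases u) (auto simp: env_carrier_def)
  have "brR t s = 0"
    using t unfolding TS_eq_tensors
    by (induction rule: tensors_induct) (use s in \<open>auto simp: brR_tensor R_index\<close>)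
  then show ?thesis using s t by (simp add: z u br_eq zero_prod_def)
qed

text \<open>On pure tensors this is \<open>lts_right\<close>. It is the exact Leibniz identity for
  \<open>[[s, q], t]\<close> with \<open>s\<close>, \<open>q\<close> in \<open>T \<otimes> T\<close>
  and \<open>t\<close> in \<open>T\<close>.\<close>

lemma brP_brR:
  assumes "s \<in> TS" "q \<in> TS"
  shows "brP t (brR q s) = brQ (brP t s) q + brP (brP t q) s"
  using assms(1)
proof (induction rule: TS_induct)
  case (tensor a b)
  show ?case
    using assms(2) unfolding TS_eq_tensors by (induction rule: tensors_induct)
      (auto simp: R_simps R_index I_simps P_simps Q_simps P_index tri_simps lts_right scale_right_distrib)
qed (use assms(2) in \<open>auto simp: R_simps P_simps Q_index scale_right_distrib\<close>)

text \<open>On pure tensors this is \<open>lts_middle\<close>. It says that the Leibniz defect of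
  \<open>[[a, q], t]\<close>, with \<open>a\<close>, \<open>t\<close> in \<open>T\<close> and
  \<open>q\<close> in \<open>T \<otimes> T\<close>, becomes zero after bracketing with any
  \<open>e\<close> in \<open>T\<close>.\<close>

lemma brP_brI:
  assumes "q \<in> TS"
  shows "brP e (brI a t q) = tri (brQ a q) t e - tri a (brP t q) e"
  using assms by (induction rule: TS_induct)
    (auto simp: I_simps P_simps Q_simps P_index tri_simps tri_diff lts_middle scale_right_diff_distrib)

lemma leibniz_mod_annihilator:
  assumes "u \<in> env_carrier scale" "w \<in> env_carrier scale"
  shows "br (br u w) (t, 0) - br (br u (t, 0)) w - br u (br w (t, 0)) \<in> tensor_annihilator"
proof -
  obtain a s where u: "u = (a, s)" and s: "s \<in> TS"
    using assms(1) by (cases u) (auto simp: env_carrier_def)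
  obtain c q where w: "w = (c, q)" and q: "q \<in> TS"
    using assms(2) by (cases w) (auto simp: env_carrier_def)
  \<comment> \<open>The pairs \<open>a, c\<close>, \<open>s, c\<close> and \<open>s, q\<close>
    satisfy the identity exactly; the defect comes from \<open>a, q\<close> alone.\<close>
  have "br (br u w) (t, 0) - br (br u (t, 0)) w - br u (br w (t, 0))
      = (0, tn (brQ a q) t - brI a t q - tn a (brP t q))"
    using s q by (simp add: u w br_eq brR_tensor brP_brR R_in_TS P_simps Q_simps R_simps I_simps tensor_simps)
  then show ?thesis
    using q I_in_TS by (simp add: tensor_annihilator_def P_simps brP_brI)
qed

section \<open>The filtration of the envelope by a nilpotent ideal\<close>

lemma incl_in_carrier: "(t, 0) \<in> env_carrier scale"
  by (simp add: env_carrier_def)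

lemma subspace_incl_preimage:
  assumes "env.subspace F"
  shows "subspace {x. (x, 0) \<in> F}"
proof (rule subspaceI)
  show "0 \<in> {x. (x, 0) \<in> F}"
    using env.subspace_0[OF assms] by (simp add: zero_prod_def)
  show "x + y \<in> {x. (x, 0) \<in> F}" if "x \<in> {x. (x, 0) \<in> F}" "y \<in> {x. (x, 0) \<in> F}" for x y
    using env.subspace_add[OF assms, of "(x, 0)" "(y, 0)"] that by simp
  show "c *s x \<in> {x. (x, 0) \<in> F}" if "x \<in> {x. (x, 0) \<in> F}" for c x
    using env.subspace_scale[OF assms, of "(x, 0)" c] that by (simp add: env_scale_Pair)
qed

lemma subspace_br_preimage:
  assumes "env.subspace F" "w \<in> env_carrier scale"
  shows "env.subspace {v \<in> env_carrier scale. br v w \<in> F}"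
    and "env.subspace {v \<in> env_carrier scale. br w v \<in> F}"
  \<comment> \<open>The instances with scalar 0 give \<open>br 0 w = 0\<close> and
    \<open>br w 0 = 0\<close>.\<close>
  using assms U.subspace_carrier U.br_scale_left[of 0 w 0] U.br_scale_right[of w 0 0]
  by (auto simp: env.subspace_def U.br_add_left U.br_add_right U.br_scale_left U.br_scale_right)

text \<open>As \<open>ideal_power V 0 = V\<close> is already one factor, the shift makes the index
  count factors from \<open>V\<close>. The annihilator is added to absorb Leibniz defects.\<close>

primrec filt :: "('a \<times> ('a, 'k) tensor) set \<Rightarrow> nat \<Rightarrow> ('a \<times> ('a, 'k) tensor) set" where
  "filt V 0 = env_carrier scale"
| "filt V (Suc n) = {v + z | v z. v \<in> U.ideal_power V n \<and> z \<in> tensor_annihilator}"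

lemma subspace_ideal_power: "U.ideal V \<Longrightarrow> env.subspace (U.ideal_power V n)"
  by (cases n) (auto simp: U.ideal_def U.br_span_def)

lemma U_idealD:
  assumes "U.ideal V"
  shows "env.subspace V" "V \<subseteq> env_carrier scale"
    "v \<in> V \<Longrightarrow> u \<in> env_carrier scale \<Longrightarrow> br v u \<in> V"
    "v \<in> V \<Longrightarrow> u \<in> env_carrier scale \<Longrightarrow> br u v \<in> V"
proof -
  have "br x y \<in> U.br_span A B" if "x \<in> A" "y \<in> B" for x y A B
    unfolding U.br_span_def using that by (intro env.span_base) blast
  then show "env.subspace V" "V \<subseteq> env_carrier scale"
    "v \<in> V \<Longrightarrow> u \<in> env_carrier scale \<Longrightarrow> br v u \<in> V"
    "v \<in> V \<Longrightarrow> u \<in> env_carrier scale \<Longrightarrow> br u v \<in> V"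
    using assms unfolding U.ideal_def by blast+
qed

lemma ideal_power_subset:
  assumes "U.ideal V"
  shows "U.ideal_power V n \<subseteq> V"
proof (induction n)
  case (Suc n)
  have "U.br_span (U.ideal_power V n) V \<subseteq> U.br_span V (env_carrier scale)"
    using Suc U_idealD(2)[OF assms] by (intro br_span_mono)
  also have "\<dots> \<subseteq> V" using assms by (simp add: U.ideal_def)
  finally show ?case by simp
qed simp

context
  fixes V assumes V: "U.ideal V"
begin

lemma subspace_filt: "env.subspace (filt V n)"
  using U.subspace_carrier env.subspace_sums[OF subspace_ideal_power[OF V] subspace_tensor_annihilator]
  by (cases n) simp_all

lemma ideal_power_subset_carrier: "U.ideal_power V n \<subseteq> env_carrier scale"
  using ideal_power_subset[OF V] U_idealD(2)[OF V] by blast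

lemma filt_subset: "filt V n \<subseteq> env_carrier scale"
proof (cases n)
  case (Suc m)
  show ?thesis
    using ideal_power_subset_carrier tensor_annihilator_subset env.subspace_add[OF U.subspace_carrier]
    unfolding Suc filt.simps by blast
qed simp

lemma tensor_annihilator_subset_filt: "tensor_annihilator \<subseteq> filt V n"
proof (cases n)
  case (Suc m)
  have "0 + z \<in> filt V n" if "z \<in> tensor_annihilator" for z
    unfolding Suc filt.simps using zero_in_ideal_power[OF V, of m] that by blast
  then show ?thesis by (simp add: subsetI)
qed (simp add: tensor_annihilator_subset)

lemma ideal_power_subset_filt: "U.ideal_power V n \<subseteq> filt V (Suc n)"
proof
  fix v assume "v \<in> U.ideal_power V n"
  then have "v + 0 \<in> filt V (Suc n)"
    unfolding filt.simps using env.subspace_0[OF subspace_tensor_annihilator] by blast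
  then show "v \<in> filt V (Suc n)" by simp
qed

text \<open>The annihilator summand vanishes in the bracket, so defects do not accumulate from one
  power to the next.\<close>

lemma br_filt_Suc:
  assumes "u \<in> filt V (Suc n)" "w \<in> env_carrier scale"
  obtains v where "v \<in> U.ideal_power V n" "br u w = br v w"
proof -
  obtain v z where u: "u = v + z" and v: "v \<in> U.ideal_power V n" and z: "z \<in> tensor_annihilator"
    using assms(1) unfolding filt.simps by blast
  have "v \<in> env_carrier scale" "z \<in> env_carrier scale"
    using v z ideal_power_subset_carrier tensor_annihilator_subset by blast+
  then have "br u w = br v w"
    using assms(2) br_tensor_annihilator[OF z assms(2)] by (simp add: u U.br_add_left)
  then show thesis using that v by blast
qed

lemma br_filt_ideal:
  assumes "u \<in> filt V n" "w \<in> V"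
  shows "br u w \<in> filt V (Suc n)"
proof (cases n)
  case 0
  then have "br u w \<in> U.ideal_power V 0" using assms U_idealD(4)[OF V] by simp
  then show ?thesis using ideal_power_subset_filt 0 by blast
next
  case (Suc m)
  then obtain v where "v \<in> U.ideal_power V m" "br u w = br v w"
    using br_filt_Suc assms U_idealD(2)[OF V] by blast
  then have "br u w \<in> U.ideal_power V (Suc m)"
    unfolding U.ideal_power.simps U.br_span_def using assms(2)
    by (metis (mono_tags, lifting) env.span_base mem_Collect_eq)
  then show ?thesis using ideal_power_subset_filt Suc by blast
qed

text \<open>Induction on the power, using \<open>[[v, w], t] = [[v, t], w] + [v, [w, t]]\<close>
  modulo the annihilator: the induction hypothesis places \<open>[v, t]\<close>, the ideal property
  gives \<open>[w, t] \<in> V\<close>, and \<open>br_filt_ideal\<close> raises both by one.\<close>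

lemma br_filt_incl:
  assumes "u \<in> filt V n"
  shows "br u (t, 0) \<in> filt V n"
proof (cases n)
  case 0
  then show ?thesis using assms U.br_closed incl_in_carrier by simp
next
  case (Suc m)
  have "br v (t, 0) \<in> filt V (Suc m)" if "v \<in> U.ideal_power V m" for v
    using that
  proof (induction m arbitrary: v)
    case 0
    then have "br v (t, 0) \<in> U.ideal_power V 0"
      using U_idealD(3)[OF V] incl_in_carrier by simp
    then show ?case using ideal_power_subset_filt by blast
  next
    case (Suc m)
    let ?F = "filt V (Suc (Suc m))"
    have "br (br v w) (t, 0) \<in> ?F" if v: "v \<in> U.ideal_power V m" and w: "w \<in> V" for v w
    proof -
      have vL: "v \<in> env_carrier scale" and wL: "w \<in> env_carrier scale"
        using v w ideal_power_subset_carrier U_idealD(2)[OF V] by auto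
      have "br (br v (t, 0)) w \<in> ?F" by (rule br_filt_ideal[OF Suc.IH[OF v] w])
      moreover have "br v (br w (t, 0)) \<in> ?F"
        using v U_idealD(3)[OF V w incl_in_carrier] ideal_power_subset_filt
        by (blast intro: br_filt_ideal)
      moreover have "br (br v w) (t, 0) - br (br v (t, 0)) w - br v (br w (t, 0)) \<in> ?F"
        using leibniz_mod_annihilator[OF vL wL] tensor_annihilator_subset_filt by blast
      ultimately show ?thesis
        using env.subspace_add[OF subspace_filt, of _ "Suc (Suc m)"]
        by (metis diff_add_cancel)
    qed
    then have "U.ideal_power V (Suc m) \<subseteq> {v \<in> env_carrier scale. br v (t, 0) \<in> ?F}"
      unfolding U.ideal_power.simps U.br_span_def
      using ideal_power_subset_carrier U_idealD(2)[OF V] U.br_closed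
      by (intro env.span_minimal subspace_br_preimage subspace_filt incl_in_carrier) blast
    then show ?case using Suc.prems by blast
  qed
  then show ?thesis using br_filt_Suc[of u m] assms Suc incl_in_carrier by metis
qed

section \<open>Degrees of right multiplications and levels in \<open>T\<close>\<close>

definition degree :: "nat \<Rightarrow> ('a \<times> ('a, 'k) tensor) set" where
  "degree m = {y \<in> env_carrier scale. \<forall>i. \<forall>u\<in>filt V i. br u y \<in> filt V (i + m)}"

lemma degreeD: "y \<in> degree m \<Longrightarrow> u \<in> filt V i \<Longrightarrow> br u y \<in> filt V (i + m)"
  by (simp add: degree_def)

lemma subspace_degree: "env.subspace (degree m)"
proof -
  have "env.subspace {y \<in> env_carrier scale. br u y \<in> filt V (i + m)}" if "u \<in> filt V i" for u i
    using that filt_subset by (intro subspace_br_preimage subspace_filt) blast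
  moreover have "degree m = env_carrier scale \<inter>
      (\<Inter>i. \<Inter>u\<in>filt V i. {y \<in> env_carrier scale. br u y \<in> filt V (i + m)})"
    unfolding degree_def by blast
  ultimately show ?thesis
    by (simp only: env.subspace_inter env.subspace_Int U.subspace_carrier)
qed

text \<open>Modulo the annihilator, right multiplication by \<open>[y, t]\<close> is the commutator of the right
  multiplications by \<open>y\<close> and by \<open>t\<close>.\<close>

lemma degree_br:
  assumes y: "y \<in> degree m" and t: "(t, 0) \<in> degree l"
  shows "br y (t, 0) \<in> degree (m + l)"
proof -
  have yL: "y \<in> env_carrier scale" using y by (simp add: degree_def)
  have "br u (br y (t, 0)) \<in> filt V (i + (m + l))" if u: "u \<in> filt V i" for u i
  proof -
    let ?F = "filt V (i + (m + l))" and ?p = "br (br u y) (t, 0)" and ?q = "br (br u (t, 0)) y"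
    have p: "?p \<in> ?F" using degreeD[OF t degreeD[OF y u]] by (simp only: add.assoc)
    have q: "?q \<in> ?F" using degreeD[OF y degreeD[OF t u]] by (simp only: add.assoc add.commute add.left_commute)
    have uL: "u \<in> env_carrier scale" using u filt_subset by blast
    have "?p - ?q - br u (br y (t, 0)) \<in> ?F"
      using leibniz_mod_annihilator[OF uL yL] tensor_annihilator_subset_filt by blast
    from env.subspace_diff[OF subspace_filt env.subspace_diff[OF subspace_filt p q] this]
    show ?thesis by simp
  qed
  then show ?thesis unfolding degree_def using U.br_closed[OF yL incl_in_carrier] by blast
qed

text \<open>In \<open>{abc} = [[a, b], c]\<close> the leftmost factor contributes through the
  filtration, the other two through the degree. Products are used again in any slot, so both
  conditions are carried together.\<close>

definition level :: "nat \<Rightarrow> 'a set" where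
  "level m = {x. (x, 0) \<in> filt V m \<and> (x, 0) \<in> degree m}"

lemma subspace_level: "subspace (level m)"
  using subspace_incl_preimage[OF env.subspace_inter[OF subspace_filt subspace_degree]]
  by (simp add: level_def)

lemma level_0: "x \<in> level 0"
  using br_filt_incl incl_in_carrier by (simp add: level_def degree_def)

lemma level_1: "(x, 0) \<in> V \<Longrightarrow> x \<in> level 1"
  using br_filt_ideal ideal_power_subset_filt[of 0] incl_in_carrier
  by (simp add: level_def degree_def subset_iff del: filt.simps)

lemma tri_level:
  assumes "a \<in> level i" "b \<in> level j" "c \<in> level k"
  shows "tri a b c \<in> level (i + j + k)"
proof -
  have "br (br (a, 0) (b, 0)) (c, 0) \<in> degree (i + j + k)"
    using assms by (auto simp: level_def intro: degree_br)
  moreover have "br (br (a, 0) (b, 0)) (c, 0) \<in> filt V (i + j + k)"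
    using assms by (auto simp: level_def degree_def)
  ultimately show ?thesis by (simp add: level_def env_bracket_rules)
qed

text \<open>The free factor from \<open>T\<close> has level 0, so each of the six products has
  factors of levels \<open>Suc n\<close>, 1 and 0 in some order. The index starts at 1 because
  \<open>K\<close> itself has level 1.\<close>

lemma ideal_power_subset_level:
  defines "K \<equiv> {x. (x, 0) \<in> V}"
  shows "ideal_power K n \<subseteq> level (Suc n)"
proof (induction n)
  case 0
  show ?case using level_1 by (auto simp: K_def)
next
  case (Suc n)
  let ?J = "ideal_power K n"
  have K: "x \<in> level 1" if "x \<in> K" for x using that level_1 by (simp add: K_def)
  have J: "x \<in> level (Suc n)" if "x \<in> ?J" for x using that Suc by blast
  show ?case
    unfolding ideal_power_Suc
  proof (rule tri_product_minimal[OF subspace_level])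
    fix a b c assume "a \<in> ?J \<and> b \<in> K \<or> a \<in> ?J \<and> c \<in> K \<or> b \<in> ?J \<and> c \<in> K \<or>
      a \<in> K \<and> b \<in> ?J \<or> a \<in> K \<and> c \<in> ?J \<or> b \<in> K \<and> c \<in> ?J"
    then show "tri a b c \<in> level (Suc (Suc n))"
      using tri_level[OF J K level_0] tri_level[OF J level_0 K] tri_level[OF level_0 J K]
        tri_level[OF K J level_0] tri_level[OF K level_0 J] tri_level[OF level_0 K J]
      by (elim disjE conjE) simp_all
  qed
qed

lemma ideal_trace: "ideal {x. (x, 0) \<in> V}"
  unfolding ideal_iff
proof (intro conjI ballI allI)
  show "subspace {x. (x, 0) \<in> V}"
    by (rule subspace_incl_preimage[OF U_idealD(1)[OF V]])
  fix x u v assume "x \<in> {x. (x, 0) \<in> V}"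
  then have x: "(x, 0) \<in> V" by simp
  note c = incl_in_carrier and r = U_idealD(3)[OF V] and l = U_idealD(4)[OF V]
  have "br (br (x, 0) (u, 0)) (v, 0) \<in> V" by (rule r[OF r[OF x c] c])
  moreover have "br (br (u, 0) (x, 0)) (v, 0) \<in> V" by (rule r[OF l[OF x c] c])
  moreover have "br (br (u, 0) (v, 0)) (x, 0) \<in> V" by (rule l[OF x U.br_closed[OF c c]])
  ultimately show "tri x u v \<in> {x. (x, 0) \<in> V}" "tri u x v \<in> {x. (x, 0) \<in> V}"
    "tri u v x \<in> {x. (x, 0) \<in> V}"
    by (simp_all add: env_bracket_rules)
qed

end

section \<open>Comparison of the two radicals\<close>

lemma nilpotent_trace:
  assumes "U.nilpotent_ideal V"
  shows "nilpotent_ideal {x. (x, 0) \<in> V}"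
proof -
  let ?K = "{x. (x, 0) \<in> V}"
  obtain n where V: "U.ideal V" and n: "U.ideal_power V n = {0}"
    using assms by (auto simp: U.nilpotent_ideal_def)
  have "filt V (Suc n) = tensor_annihilator"
    unfolding filt.simps n by (simp del: split_paired_Ex)
  \<comment> \<open>The filtration half of \<open>level\<close> forces this: elements of the
    annihilator have zero component in \<open>T\<close>.\<close>
  then have "level V (Suc n) \<subseteq> {0}"
    by (auto simp: level_def[OF V] tensor_annihilator_def simp del: filt.simps)
  then have "ideal_power ?K n \<subseteq> {0}"
    using ideal_power_subset_level[OF V, of n] by (rule order_trans[rotated])
  moreover have "0 \<in> ideal_power ?K n"
    using ideal_ideal_power[OF ideal_trace[OF V]] by (intro subspace_0 idealD(1))
  ultimately have "ideal_power ?K n = {0}" by blast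
  then show ?thesis
    using ideal_trace[OF V] unfolding nilpotent_ideal_def by blast
qed

text \<open>The trace of \<open>N\<close> is itself a nilpotent ideal and contains every other
  nilpotent ideal \<open>I\<close>, since \<open>env_ideal I \<subseteq> N\<close> by maximality.
  Hence the sum of all of them collapses to one member.\<close>

lemma nil_radical_eq_trace:
  assumes "U.is_nilpotent_radical N"
  shows "nil_radical = {x. (x, 0) \<in> N}"
proof
  have N: "U.nilpotent_ideal N" and max: "\<And>W. U.nilpotent_ideal W \<Longrightarrow> W \<subseteq> N"
    using assms by (auto simp: U.is_nilpotent_radical_def)
  have K: "nilpotent_ideal {x. (x, 0) \<in> N}" using N by (rule nilpotent_trace)
  have I: "I \<subseteq> {x. (x, 0) \<in> N}" if "nilpotent_ideal I" for I
  proof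
    have "subspace I" using that unfolding nilpotent_ideal_def ideal_def by blast
    fix a assume "a \<in> I"
    then show "a \<in> {x. (x, 0) \<in> N}"
      using max[OF nilpotent_env_ideal[OF that]] env_ideal_incl[OF \<open>subspace I\<close>] by blast
  qed
  have "subspace {x. (x, 0) \<in> N}" using K unfolding nilpotent_ideal_def ideal_def by blast
  then show "nil_radical \<subseteq> {x. (x, 0) \<in> N}"
    unfolding nil_radical_def by (intro span_minimal Union_least I) simp_all
  have "{x. (x, 0) \<in> N} \<subseteq> \<Union>{I. nilpotent_ideal I}" using K by (intro Union_upper) simp
  also have "\<dots> \<subseteq> nil_radical" unfolding nil_radical_def by (rule span_superset)
  finally show "{x. (x, 0) \<in> N} \<subseteq> nil_radical" .
qed

end

theorem theorem6p9:
  fixes scale :: "'k::field_char_0 \<Rightarrow> 'a::ab_group_add \<Rightarrow> 'a"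
    and tri :: "'a \<Rightarrow> 'a \<Rightarrow> 'a \<Rightarrow> 'a"
    and Nil_U :: "('a \<times> ('a, 'k) tensor) set"
  assumes "leibniz_triple_system scale tri"
    and "bracket_algebra.is_nilpotent_radical
           (env_scale scale) (env_carrier scale) (env_bracket scale tri) Nil_U"
  shows "env_incl ` leibniz_triple_system.nil_radical scale tri = Nil_U \<inter> range env_incl"
  using leibniz_triple_system.nil_radical_eq_trace[OF assms] by (auto simp: env_incl_def)

end
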